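(* Let $\langle\cdot,\cdot\rangle$ be a quasi-definite bilinear form on $\mathbb{C}[x]$, and let $\{P_{1,k}\}_{k\ge0}$, $\{P_{2,k}\}_{k\ge0}$ be the two families of monic polynomials and $H_k$ the numbers constructed from the $LDU$ factorization of its Gram matrix. Then the families are biorthogonal: $$\langle P_{1,k}(x),P_{2,l}(y)\rangle=\delta_{l,k}H_k,\qquad k,l\ge 0.$$
   Context: The Gram matrix of a bilinear form on $\mathbb{C}[x]$ is $G=(G_{k,l})_{k,l\ge0}$, $G_{k,l}=\langle x^k,y^l\rangle$ (no complex conjugation; the letters $x$, $y$ mark the first and second argument). The form is quasi-definite if all leading principal minors of $G$ are nonzero. In that case $G$ factors uniquely as $G=S_1^{-1}HS_2^{-\top}$ with $S_1,S_2$ semi-infinite lower unitriangular matrices and $H=\operatorname{diag}(H_0,H_1,\dots)$. With $\chi(x)=(1,x,x^2,\dots)^\top$, define $P_1=S_1\chi=(P_{1,0},P_{1,1},\dots)^\top$ and $P_2=S_2\chi=(P_{2,0},P_{2,1},\dots)^\top$; $P_{i,k}$ is monic of degree $k$. *)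

theory Defs
  imports
    "Jordan_Normal_Form.Determinant"
    "HOL-Computational_Algebra.Polynomial"
    "HOL-Library.Groups_Big_Fun"
    Complex_Main
begin

text \<open>Bilinearity is over the complex numbers in both arguments (not sesquilinear).\<close>

definition bilinear_form :: "(complex poly \<Rightarrow> complex poly \<Rightarrow> complex) \<Rightarrow> bool" where
  "bilinear_form B \<longleftrightarrow>
     (\<forall>p. Vector_Spaces.linear smult (*) (\<lambda>q. B p q)) \<and>
     (\<forall>q. Vector_Spaces.linear smult (*) (\<lambda>p. B p q))"

text \<open>Semi-infinite matrices are indexed by all natural numbers. \<^const>\<open>Sum_any\<close> sums over
  the indices with a nonzero summand, so a product is meaningful as soon as, in each entry,
  only finitely many summands are nonzero; this is the case if the left factor is lower
  triangular.\<close>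

type_synonym smat = "nat \<Rightarrow> nat \<Rightarrow> complex"

definition smat_one :: smat where
  "smat_one k l = (if k = l then 1 else 0)"

definition smat_times :: "smat \<Rightarrow> smat \<Rightarrow> smat" where
  "smat_times A B k l = Sum_any (\<lambda>j. A k j * B j l)"

definition smat_transpose :: "smat \<Rightarrow> smat" where
  "smat_transpose A k l = A l k"

definition smat_diag :: "(nat \<Rightarrow> complex) \<Rightarrow> smat" where
  "smat_diag H k l = (if k = l then H k else 0)"

definition lower_unitriangular :: "smat \<Rightarrow> bool" where
  "lower_unitriangular A \<longleftrightarrow> (\<forall>k. A k k = 1) \<and> (\<forall>k l. k < l \<longrightarrow> A k l = 0)"

text \<open>Inverse within the group of lower unitriangular matrices; only meaningful for members of
  that group.\<close>

definition smat_inverse :: "smat \<Rightarrow> smat" where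
  "smat_inverse A = (THE L. lower_unitriangular L \<and>
     smat_times L A = smat_one \<and> smat_times A L = smat_one)"

definition gram :: "(complex poly \<Rightarrow> complex poly \<Rightarrow> complex) \<Rightarrow> smat" where
  "gram B k l = B (monom 1 k) (monom 1 l)"

definition quasi_definite :: "(complex poly \<Rightarrow> complex poly \<Rightarrow> complex) \<Rightarrow> bool" where
  "quasi_definite B \<longleftrightarrow> (\<forall>n. det (mat n n (\<lambda>(k, l). gram B k l)) \<noteq> 0)"

definition is_LDU :: "smat \<Rightarrow> smat \<Rightarrow> (nat \<Rightarrow> complex) \<Rightarrow> smat \<Rightarrow> bool" where
  "is_LDU G S1 H S2 \<longleftrightarrow> lower_unitriangular S1 \<and> lower_unitriangular S2 \<and>
     G = smat_times (smat_times (smat_inverse S1) (smat_diag H))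
           (smat_transpose (smat_inverse S2))"

text \<open>The factorization exists and is unique if all leading principal minors of the matrix are
  nonzero; otherwise the following triple need not be meaningful.\<close>

definition LDU :: "smat \<Rightarrow> smat \<times> (nat \<Rightarrow> complex) \<times> smat" where
  "LDU G = (THE (S1, H, S2). is_LDU G S1 H S2)"

definition LDU_S1 :: "smat \<Rightarrow> smat" where
  "LDU_S1 G = fst (LDU G)"

definition LDU_H :: "smat \<Rightarrow> nat \<Rightarrow> complex" where
  "LDU_H G = fst (snd (LDU G))"

definition LDU_S2 :: "smat \<Rightarrow> smat" where
  "LDU_S2 G = snd (snd (LDU G))"

definition chi :: "nat \<Rightarrow> complex poly" where
  "chi k = monom 1 k"

definition smat_apply :: "smat \<Rightarrow> (nat \<Rightarrow> complex poly) \<Rightarrow> nat \<Rightarrow> complex poly" where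
  "smat_apply A v k = Sum_any (\<lambda>j. smult (A k j) (v j))"

definition P1 :: "(complex poly \<Rightarrow> complex poly \<Rightarrow> complex) \<Rightarrow> nat \<Rightarrow> complex poly" where
  "P1 B = smat_apply (LDU_S1 (gram B)) chi"

definition P2 :: "(complex poly \<Rightarrow> complex poly \<Rightarrow> complex) \<Rightarrow> nat \<Rightarrow> complex poly" where
  "P2 B = smat_apply (LDU_S2 (gram B)) chi"

end

theory Submission
  imports Defs
begin

text \<open>
  Expanding both arguments by bilinearity shows that the number \<open>B (P1 B k) (P2 B l)\<close> is the
  \<open>(k, l)\<close> entry of \<open>S\<^sub>1 G S\<^sub>2\<^sup>T\<close>, where \<open>G\<close> is the Gram matrix. Since \<open>G = S\<^sub>1\<^sup>-\<^sup>1 H S\<^sub>2\<^sup>-\<^sup>T\<close>,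
  this product is the diagonal matrix \<open>H\<close>, which is biorthogonality.

  What remains is that the factorization exists and is unique, because the factors are
  introduced by a definite description. The point is that \<open>S\<^sub>1\<close> can be characterized without
  reference to \<open>H\<close> and \<open>S\<^sub>2\<close>: it is the lower unitriangular matrix for which \<open>S\<^sub>1 G\<close> is upper
  triangular. Row \<open>k\<close> of this condition is a linear system for the \<open>k\<close> entries of \<open>S\<^sub>1\<close> to the
  left of the diagonal, and its coefficient matrix is the transposed leading \<open>k \<times> k\<close> block of
  \<open>G\<close>; it has exactly one solution because the block has a nonzero determinant
  (\<open>ex1_triangularizer\<close>). By transposition, \<open>S\<^sub>2\<close> is the one matrix for which \<open>S\<^sub>2 G\<^sup>T\<close> is upper
  triangular. For this pair, \<open>S\<^sub>1 G S\<^sub>2\<^sup>T\<close> is both upper and lower triangular, so it is diagonal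
  (\<open>ex1_LDU\<close>).
\<close>

section \<open>Products with triangular factors\<close>

text \<open>With a lower triangular factor on the left, or an upper triangular one on the right, the
  sum over all indices is an ordinary finite sum.\<close>

lemma Sum_any_eq_sum_atMost:
  fixes f :: "nat \<Rightarrow> 'a::comm_monoid_add"
  assumes "\<And>j. n < j \<Longrightarrow> f j = 0"
  shows "Sum_any f = sum f {..n}"
proof (rule Sum_any.expand_superset)
  show "{j. f j \<noteq> 0} \<subseteq> {..n}"
    using assms by (auto simp: not_less[symmetric])
qed simp

lemma smat_times_lower_left:
  assumes "lower_unitriangular A"
  shows "smat_times A M k l = (\<Sum>j\<le>k. A k j * M j l)"
  using assms unfolding smat_times_def lower_unitriangular_def
  by (intro Sum_any_eq_sum_atMost) auto

lemma smat_transpose_times: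
  "smat_transpose (smat_times A M) = smat_times (smat_transpose M) (smat_transpose A)"
  by (intro ext) (simp add: smat_times_def smat_transpose_def mult.commute)

lemma smat_transpose_transpose [simp]: "smat_transpose (smat_transpose A) = A"
  by (intro ext) (simp add: smat_transpose_def)

lemma smat_transpose_one [simp]: "smat_transpose smat_one = smat_one"
  by (intro ext) (simp add: smat_transpose_def smat_one_def)

lemma smat_transpose_diag [simp]: "smat_transpose (smat_diag H) = smat_diag H"
  by (intro ext) (simp add: smat_transpose_def smat_diag_def)

lemma smat_times_upper_right:
  assumes "lower_unitriangular A"
  shows "smat_times M (smat_transpose A) k l = (\<Sum>j\<le>l. M k j * A l j)"
  using assms unfolding smat_times_def lower_unitriangular_def smat_transpose_def
  by (intro Sum_any_eq_sum_atMost) auto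

lemma lower_unitriangular_one: "lower_unitriangular smat_one"
  by (simp add: lower_unitriangular_def smat_one_def)

lemma smat_one_times [simp]: "smat_times smat_one M = M"
  by (intro ext, subst smat_times_lower_left[OF lower_unitriangular_one])
     (simp add: smat_one_def if_distrib[of "\<lambda>x. x * _"] cong: if_cong)

lemma smat_times_one [simp]: "smat_times M smat_one = M"
  using smat_transpose_times[of smat_one "smat_transpose M"] by simp

text \<open>Products of semi-infinite matrices are not associative in general. Associativity holds in
  the following three cases, where all sums involved are finite.\<close>

lemma smat_times_assoc_lower_upper:
  assumes "lower_unitriangular A" "lower_unitriangular C"
  shows "smat_times (smat_times A M) (smat_transpose C)
       = smat_times A (smat_times M (smat_transpose C))"
proof (intro ext)
  fix k l
  have "smat_times (smat_times A M) (smat_transpose C) k l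
      = (\<Sum>j\<le>l. \<Sum>i\<le>k. A k i * M i j * C l j)"
    by (simp add: smat_times_upper_right[OF assms(2)] smat_times_lower_left[OF assms(1)]
        sum_distrib_right)
  also have "\<dots> = (\<Sum>i\<le>k. \<Sum>j\<le>l. A k i * M i j * C l j)"
    by (rule sum.swap)
  also have "\<dots> = smat_times A (smat_times M (smat_transpose C)) k l"
    by (simp add: smat_times_upper_right[OF assms(2)] smat_times_lower_left[OF assms(1)]
        sum_distrib_left mult.assoc)
  finally show "smat_times (smat_times A M) (smat_transpose C) k l
      = smat_times A (smat_times M (smat_transpose C)) k l" .
qed

lemma lower_unitriangular_times:
  assumes "lower_unitriangular A" "lower_unitriangular C"
  shows "lower_unitriangular (smat_times A C)"
proof -
  have "(\<Sum>j\<le>k. A k j * C j k) = 1" for k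
  proof -
    have "(\<Sum>j\<le>k. A k j * C j k) = (\<Sum>j\<le>k. if j = k then 1 else 0)"
      using assms by (intro sum.cong) (auto simp: lower_unitriangular_def)
    then show ?thesis by simp
  qed
  moreover have "(\<Sum>j\<le>k. A k j * C j l) = 0" if "k < l" for k l
    using assms that by (intro sum.neutral) (auto simp: lower_unitriangular_def)
  ultimately show ?thesis
    by (simp add: lower_unitriangular_def smat_times_lower_left[OF assms(1)])
qed

lemma smat_times_assoc_lower_lower:
  assumes "lower_unitriangular A" "lower_unitriangular C"
  shows "smat_times (smat_times A C) M = smat_times A (smat_times C M)"
proof (intro ext)
  fix k l
  have C: "(\<Sum>j\<le>i. C i j * M j l) = (\<Sum>j\<le>k. C i j * M j l)" if "i \<le> k" for i
    using that assms(2) by (intro sum.mono_neutral_left) (auto simp: lower_unitriangular_def)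
  have "smat_times (smat_times A C) M k l = (\<Sum>j\<le>k. \<Sum>i\<le>k. A k i * C i j * M j l)"
    by (simp add: smat_times_lower_left lower_unitriangular_times assms sum_distrib_right)
  also have "\<dots> = (\<Sum>i\<le>k. \<Sum>j\<le>k. A k i * C i j * M j l)"
    by (rule sum.swap)
  also have "\<dots> = (\<Sum>i\<le>k. A k i * (\<Sum>j\<le>i. C i j * M j l))"
    by (simp add: C sum_distrib_left mult.assoc)
  also have "\<dots> = smat_times A (smat_times C M) k l"
    by (simp add: smat_times_lower_left assms)
  finally show "smat_times (smat_times A C) M k l = smat_times A (smat_times C M) k l" .
qed

lemma smat_times_assoc_upper_upper:
  assumes "lower_unitriangular A" "lower_unitriangular C"
  shows "smat_times (smat_times M (smat_transpose C)) (smat_transpose A)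
       = smat_times M (smat_times (smat_transpose C) (smat_transpose A))"
  using arg_cong[OF smat_times_assoc_lower_lower[OF assms, of "smat_transpose M"],
      of smat_transpose]
  by (simp add: smat_transpose_times)

section \<open>Inverses of lower unitriangular matrices\<close>

text \<open>Forward substitution in \<open>A R = 1\<close>, one row of \<open>R\<close> after the other.\<close>

fun forward_subst :: "smat \<Rightarrow> nat \<Rightarrow> nat \<Rightarrow> complex" where
  "forward_subst A k l = smat_one k l - (\<Sum>j<k. A k j * forward_subst A j l)"

declare forward_subst.simps [simp del]

lemma ex_right_inverse:
  assumes A: "lower_unitriangular A"
  shows "\<exists>R. lower_unitriangular R \<and> smat_times A R = smat_one"
proof (intro exI conjI)
  let ?R = "forward_subst A"
  have zero: "?R k l = 0" if "k < l" for k l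
    using that
  proof (induction k rule: less_induct)
    case (less k)
    have "(\<Sum>j<k. A k j * ?R j l) = 0"
      using less by (intro sum.neutral) auto
    then show ?case
      using less.prems by (simp add: forward_subst.simps[of A k] smat_one_def)
  qed
  have "(\<Sum>j<k. A k j * ?R j k) = 0" for k
    by (intro sum.neutral) (auto simp: zero)
  then have "?R k k = 1" for k
    by (simp add: forward_subst.simps[of A k] smat_one_def)
  with zero show "lower_unitriangular ?R"
    by (simp add: lower_unitriangular_def)
  show "smat_times A ?R = smat_one"
  proof (intro ext)
    fix k l
    have "smat_times A ?R k l = ?R k l + (\<Sum>j<k. A k j * ?R j l)"
      using A by (simp add: smat_times_lower_left lessThan_Suc_atMost[symmetric]
          lower_unitriangular_def)
    then show "smat_times A ?R k l = smat_one k l"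
      by (simp add: forward_subst.simps[of A k])
  qed
qed

text \<open>Right inverses that stay in the set make an associative structure a group, so that the
  right inverse is the only two-sided inverse.\<close>

lemma ex1_inverse:
  assumes A: "lower_unitriangular A"
  shows "\<exists>!L. lower_unitriangular L \<and> smat_times L A = smat_one \<and> smat_times A L = smat_one"
proof -
  obtain R where R: "lower_unitriangular R" "smat_times A R = smat_one"
    using ex_right_inverse[OF A] by blast
  obtain A' where A': "lower_unitriangular A'" "smat_times R A' = smat_one"
    using ex_right_inverse[OF R(1)] by blast
  have "A = smat_times A (smat_times R A')"
    by (simp add: A')
  also have "\<dots> = A'"
    by (simp add: smat_times_assoc_lower_lower[OF A R(1), symmetric] R)
  finally have left: "smat_times R A = smat_one"
    using A' by simp
  have "L = R" if L: "lower_unitriangular L" "smat_times L A = smat_one" for L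
    using smat_times_assoc_lower_lower[OF L(1) A, of R] L R by simp
  with R left show ?thesis
    by blast
qed

lemma smat_inverse:
  assumes "lower_unitriangular A"
  shows lower_unitriangular_inverse: "lower_unitriangular (smat_inverse A)"
    and smat_inverse_times: "smat_times (smat_inverse A) A = smat_one"
    and smat_times_inverse: "smat_times A (smat_inverse A) = smat_one"
  using theI'[OF ex1_inverse[OF assms]] unfolding smat_inverse_def by blast+

section \<open>Existence and uniqueness of the LDU factorization\<close>

text \<open>The factorization with the inverses moved to the other side. This form is symmetric under
  transposition, and it is the one that bilinearity meets.\<close>

lemma is_LDU_iff:
  "is_LDU G S1 H S2 \<longleftrightarrow> lower_unitriangular S1 \<and> lower_unitriangular S2 \<and>
     smat_times (smat_times S1 G) (smat_transpose S2) = smat_diag H"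
proof (cases "lower_unitriangular S1 \<and> lower_unitriangular S2")
  case True
  then have S: "lower_unitriangular S1" "lower_unitriangular S2" by auto
  let ?L1 = "smat_inverse S1" and ?L2 = "smat_inverse S2" and ?D = "smat_diag H"
  note L = lower_unitriangular_inverse[OF S(1)] lower_unitriangular_inverse[OF S(2)]
  have T: "smat_times (smat_transpose ?L2) (smat_transpose S2) = smat_one"
    "smat_times (smat_transpose S2) (smat_transpose ?L2) = smat_one"
    by (simp_all add: smat_transpose_times[symmetric] smat_inverse_times smat_times_inverse S)
  have "smat_times (smat_times S1 G) (smat_transpose S2) = ?D"
    if G: "G = smat_times (smat_times ?L1 ?D) (smat_transpose ?L2)"
  proof -
    have "smat_times S1 G = smat_times ?D (smat_transpose ?L2)"
      unfolding G
      by (simp add: smat_times_assoc_lower_upper[OF S(1) L(2), symmetric]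
          smat_times_assoc_lower_lower[OF S(1) L(1), symmetric] smat_times_inverse S)
    then show ?thesis
      by (simp add: smat_times_assoc_upper_upper[OF S(2) L(2)] T)
  qed
  moreover have "G = smat_times (smat_times ?L1 ?D) (smat_transpose ?L2)"
    if D: "smat_times (smat_times S1 G) (smat_transpose S2) = ?D"
  proof -
    have "smat_times ?L1 ?D = smat_times G (smat_transpose S2)"
      unfolding D[symmetric]
      by (simp add: smat_times_assoc_lower_upper[OF L(1) S(2), symmetric]
          smat_times_assoc_lower_lower[OF L(1) S(1), symmetric] smat_inverse_times S)
    then show ?thesis
      by (simp add: smat_times_assoc_upper_upper[OF L(2) S(2)] T)
  qed
  ultimately show ?thesis
    using S unfolding is_LDU_def by blast
qed (auto simp: is_LDU_def)

lemma is_LDU_transpose: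
  assumes "is_LDU G S1 H S2"
  shows "is_LDU (smat_transpose G) S2 H S1"
proof -
  have S: "lower_unitriangular S1" "lower_unitriangular S2"
    and D: "smat_times (smat_times S1 G) (smat_transpose S2) = smat_diag H"
    using assms by (auto simp: is_LDU_iff)
  show ?thesis
    using arg_cong[OF D, of smat_transpose] S
    by (simp add: is_LDU_iff smat_transpose_times smat_times_assoc_lower_upper)
qed

definition minors_nonzero :: "smat \<Rightarrow> bool" where
  "minors_nonzero G \<longleftrightarrow> (\<forall>n. det (mat n n (\<lambda>(k, l). G k l)) \<noteq> 0)"

lemma det_leading_block_transpose:
  "det (mat n n (\<lambda>(k, l). smat_transpose G k l)) = det (mat n n (\<lambda>(k, l). G k l))"
proof -
  have "mat n n (\<lambda>(k, l). smat_transpose G k l) = transpose_mat (mat n n (\<lambda>(k, l). G k l))"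
    by (rule eq_matI) (auto simp: smat_transpose_def)
  then show ?thesis
    by (simp add: det_transpose[of _ n])
qed

lemma minors_nonzero_transpose:
  "minors_nonzero G \<Longrightarrow> minors_nonzero (smat_transpose G)"
  by (simp add: minors_nonzero_def det_leading_block_transpose)

text \<open>Unknowns are functions on all natural numbers here, of which only the values below \<open>n\<close>
  matter; hence uniqueness is agreement below \<open>n\<close>.\<close>

lemma row_system_solvable:
  assumes "det (mat n n (\<lambda>(k, l). G k l)) \<noteq> (0::complex)"
  shows ex_row_solution: "\<exists>s. \<forall>l<n. (\<Sum>j<n. s j * G j l) = b l"
    and row_solution_unique:
      "\<lbrakk>\<forall>l<n. (\<Sum>j<n. s j * G j l) = (\<Sum>j<n. t j * G j l); j < n\<rbrakk> \<Longrightarrow> s j = t j"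
proof -
  \<comment> \<open>The unknowns multiply \<open>G\<close> from the left; as a column vector they are acted on by \<open>G\<^sup>T\<close>.\<close>
  define M where "M = mat n n (\<lambda>(k, l). smat_transpose G k l)"
  have M: "M \<in> carrier_mat n n"
    by (simp add: M_def)
  have "det M \<noteq> 0"
    using assms by (simp add: M_def det_leading_block_transpose)
  then have "M \<in> Units (ring_mat TYPE(complex) n ())"
    by (rule det_non_zero_imp_unit[OF M])
  then obtain N where N: "N \<in> carrier_mat n n" "N * M = 1\<^sub>m n" "M * N = 1\<^sub>m n"
    by (auto simp: Units_def ring_mat_def)
  have prod: "(M *\<^sub>v vec n s) $ l = (\<Sum>j<n. s j * G j l)" if "l < n" for s l
    using that by (auto simp: M_def scalar_prod_def smat_transpose_def mult.commute
        atLeast0LessThan intro!: sum.cong)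
  show "\<exists>s. \<forall>l<n. (\<Sum>j<n. s j * G j l) = b l"
  proof (intro exI allI impI)
    fix l assume l: "l < n"
    define v where "v = N *\<^sub>v vec n b"
    have v: "vec n (\<lambda>j. v $ j) = v"
      using N(1) by (intro eq_vecI) (auto simp: v_def)
    have "M *\<^sub>v v = (M * N) *\<^sub>v vec n b"
      unfolding v_def by (rule assoc_mult_mat_vec[OF M N(1), symmetric]) simp
    also have "\<dots> = vec n b"
      by (simp add: N(3))
    finally have Mv: "M *\<^sub>v v = vec n b" .
    have "(\<Sum>j<n. v $ j * G j l) = (M *\<^sub>v vec n (\<lambda>j. v $ j)) $ l"
      by (rule prod[OF l, symmetric])
    also have "\<dots> = b l"
      by (simp only: v Mv index_vec[OF l])
    finally show "(\<Sum>j<n. (N *\<^sub>v vec n b) $ j * G j l) = b l"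
      by (simp only: v_def)
  qed
  assume eq: "\<forall>l<n. (\<Sum>j<n. s j * G j l) = (\<Sum>j<n. t j * G j l)" and j: "j < n"
  have inv: "N *\<^sub>v (M *\<^sub>v vec n u) = vec n u" for u
  proof -
    have "N *\<^sub>v (M *\<^sub>v vec n u) = (N * M) *\<^sub>v vec n u"
      by (rule assoc_mult_mat_vec[OF N(1) M, symmetric]) simp
    then show ?thesis
      by (simp add: N(2))
  qed
  have "M *\<^sub>v vec n s = M *\<^sub>v vec n t"
    using M eq by (intro eq_vecI) (simp_all only: prod dim_mult_mat_vec carrier_matD)
  then have "N *\<^sub>v (M *\<^sub>v vec n s) = N *\<^sub>v (M *\<^sub>v vec n t)"
    by (rule arg_cong)
  then have "vec n s = vec n t"
    by (simp only: inv)
  then have "vec n s $ j = vec n t $ j"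
    by (rule arg_cong)
  then show "s j = t j"
    using j by (simp only: index_vec)
qed

definition upper_triangular_smat :: "smat \<Rightarrow> bool" where
  "upper_triangular_smat M \<longleftrightarrow> (\<forall>k l. l < k \<longrightarrow> M k l = 0)"

text \<open>As \<open>S k k = 1\<close>, the entries of row \<open>k\<close> below the diagonal vanish in \<open>S G\<close> if and only if
  the \<open>S k j\<close> with \<open>j < k\<close> solve the system with the right-hand side \<open>- G k l\<close>, for \<open>l < k\<close>.
  The leading block of order \<open>k\<close> is regular.\<close>

lemma ex1_triangularizer:
  assumes G: "minors_nonzero G"
  shows "\<exists>!S. lower_unitriangular S \<and> upper_triangular_smat (smat_times S G)"
proof -
  have det: "det (mat n n (\<lambda>(k, l). G k l)) \<noteq> 0" for n
    using G by (simp add: minors_nonzero_def)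
  have row: "smat_times S G k l = (\<Sum>j<k. S k j * G j l) + G k l"
    if "lower_unitriangular S" for S k l
    using that by (simp add: smat_times_lower_left lessThan_Suc_atMost[symmetric]
        lower_unitriangular_def)
  show ?thesis
  proof (rule ex_ex1I)
    have "\<forall>k. \<exists>s. \<forall>l<k. (\<Sum>j<k. s j * G j l) = - G k l"
      by (intro allI ex_row_solution[OF det])
    from choice[OF this] obtain s
      where s: "\<And>k l. l < k \<Longrightarrow> (\<Sum>j<k. s k j * G j l) = - G k l"
      by blast
    define S :: smat where "S k j = (if j < k then s k j else if j = k then 1 else 0)" for k j
    have S: "lower_unitriangular S"
      by (simp add: lower_unitriangular_def S_def)
    moreover have "upper_triangular_smat (smat_times S G)"
      unfolding upper_triangular_smat_def row[OF S] by (simp add: S_def s)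
    ultimately show "\<exists>S. lower_unitriangular S \<and> upper_triangular_smat (smat_times S G)"
      by blast
  next
    fix S T
    assume "lower_unitriangular S \<and> upper_triangular_smat (smat_times S G)"
      and "lower_unitriangular T \<and> upper_triangular_smat (smat_times T G)"
    then have S: "lower_unitriangular S" "upper_triangular_smat (smat_times S G)"
      and T: "lower_unitriangular T" "upper_triangular_smat (smat_times T G)"
      by auto
    show "S = T"
    proof (intro ext)
      fix k j
      have "(\<Sum>j<k. S k j * G j l) = (\<Sum>j<k. T k j * G j l)" if "l < k" for l
      proof -
        have "smat_times S G k l = smat_times T G k l"
          using S(2) T(2) that by (simp add: upper_triangular_smat_def)
        then show ?thesis
          by (simp add: row S T)
      qed
      then have "S k j = T k j" if "j < k"
        using row_solution_unique[OF det, of k "S k" "T k" j] that by simp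
      then show "S k j = T k j"
        using S(1) T(1) by (cases j k rule: linorder_cases) (auto simp: lower_unitriangular_def)
    qed
  qed
qed

lemma upper_triangular_times_transpose:
  assumes "upper_triangular_smat M" "lower_unitriangular S"
  shows "upper_triangular_smat (smat_times M (smat_transpose S))"
  using assms by (auto simp: upper_triangular_smat_def smat_times_upper_right intro!: sum.neutral)

lemma upper_triangular_diag: "upper_triangular_smat (smat_diag H)"
  by (simp add: upper_triangular_smat_def smat_diag_def)

text \<open>This separates \<open>S\<^sub>1\<close> from the other two factors: \<open>S\<^sub>1 G = H S\<^sub>2\<^sup>-\<^sup>T\<close>.\<close>

lemma is_LDU_imp_triangularizer:
  assumes "is_LDU G S1 H S2"
  shows "lower_unitriangular S1 \<and> upper_triangular_smat (smat_times S1 G)"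
proof -
  have S: "lower_unitriangular S1" "lower_unitriangular S2"
    and D: "smat_times (smat_times S1 G) (smat_transpose S2) = smat_diag H"
    using assms by (auto simp: is_LDU_iff)
  note L2 = lower_unitriangular_inverse[OF S(2)]
  have "smat_times S1 G = smat_times (smat_diag H) (smat_transpose (smat_inverse S2))"
    by (simp add: D[symmetric] smat_times_assoc_upper_upper[OF L2 S(2)]
        smat_transpose_times[symmetric] smat_inverse_times S)
  then show ?thesis
    using S(1) upper_triangular_times_transpose[OF upper_triangular_diag L2] by simp
qed

lemma ex1_LDU:
  assumes G: "minors_nonzero G"
  shows "\<exists>!(S1, H, S2). is_LDU G S1 H S2"
proof (rule ex_ex1I)
  obtain S1 where S1: "lower_unitriangular S1" "upper_triangular_smat (smat_times S1 G)"
    using ex1_triangularizer[OF G] by blast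
  obtain S2 where S2: "lower_unitriangular S2"
    "upper_triangular_smat (smat_times S2 (smat_transpose G))"
    using ex1_triangularizer[OF minors_nonzero_transpose[OF G]] by blast
  define D where "D = smat_times (smat_times S1 G) (smat_transpose S2)"
  have D: "upper_triangular_smat D"
    unfolding D_def by (rule upper_triangular_times_transpose[OF S1(2) S2(1)])
  have "smat_transpose D = smat_times (smat_times S2 (smat_transpose G)) (smat_transpose S1)"
    by (simp add: D_def smat_transpose_times smat_times_assoc_lower_upper S1 S2)
  then have DT: "upper_triangular_smat (smat_transpose D)"
    by (simp add: upper_triangular_times_transpose[OF S2(2) S1(1)])
  have "D k l = smat_diag (\<lambda>k. D k k) k l" for k l
    using D DT by (cases k l rule: linorder_cases)
      (auto simp: upper_triangular_smat_def smat_transpose_def smat_diag_def)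
  then have "D = smat_diag (\<lambda>k. D k k)"
    by blast
  then have "is_LDU G S1 (\<lambda>k. D k k) S2"
    using S1 S2 D_def by (simp add: is_LDU_iff)
  then show "\<exists>p. case p of (S1, H, S2) \<Rightarrow> is_LDU G S1 H S2"
    by blast
next
  fix p q :: "smat \<times> (nat \<Rightarrow> complex) \<times> smat"
  assume p: "case p of (S1, H, S2) \<Rightarrow> is_LDU G S1 H S2"
    and q: "case q of (S1, H, S2) \<Rightarrow> is_LDU G S1 H S2"
  obtain S1 H S2 T1 K T2 where pq: "p = (S1, H, S2)" "q = (T1, K, T2)"
    by (cases p, cases q) auto
  have S: "is_LDU G S1 H S2" and T: "is_LDU G T1 K T2"
    using p q pq by auto
  have 1: "S1 = T1"
    using ex1_triangularizer[OF G] is_LDU_imp_triangularizer[OF S]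
      is_LDU_imp_triangularizer[OF T] by blast
  have 2: "S2 = T2"
    using ex1_triangularizer[OF minors_nonzero_transpose[OF G]]
      is_LDU_imp_triangularizer[OF is_LDU_transpose[OF S]]
      is_LDU_imp_triangularizer[OF is_LDU_transpose[OF T]] by blast
  have "smat_diag H = smat_diag K"
    using S T by (simp add: is_LDU_iff 1 2)
  then have "H k = K k" for k
    by (metis smat_diag_def)
  with 1 2 show "p = q"
    by (auto simp: pq)
qed

lemma is_LDU_LDU:
  assumes "minors_nonzero G"
  shows "is_LDU G (LDU_S1 G) (LDU_H G) (LDU_S2 G)"
proof -
  have "case LDU G of (S1, H, S2) \<Rightarrow> is_LDU G S1 H S2"
    unfolding LDU_def by (rule theI'[OF ex1_LDU[OF assms]])
  then show ?thesis
    by (cases "LDU G") (simp add: LDU_S1_def LDU_H_def LDU_S2_def)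
qed

section \<open>Biorthogonality\<close>

lemma smat_apply_lower:
  assumes "lower_unitriangular S"
  shows "smat_apply S v k = (\<Sum>j\<le>k. smult (S k j) (v j))"
  using assms unfolding smat_apply_def lower_unitriangular_def
  by (intro Sum_any_eq_sum_atMost) auto

lemma bilinear_form_sum:
  assumes "bilinear_form B"
  shows "B (\<Sum>i\<in>I. smult (a i) (v i)) (\<Sum>j\<in>J. smult (b j) (w j))
       = (\<Sum>j\<in>J. \<Sum>i\<in>I. a i * B (v i) (w j) * b j)"
proof -
  interpret R: Vector_Spaces.linear smult "(*)" "\<lambda>q. B p q" for p
    using assms by (simp add: bilinear_form_def)
  interpret L: Vector_Spaces.linear smult "(*)" "\<lambda>p. B p q" for q
    using assms by (simp add: bilinear_form_def)
  have "B (\<Sum>i\<in>I. smult (a i) (v i)) (\<Sum>j\<in>J. smult (b j) (w j))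
      = (\<Sum>j\<in>J. b j * B (\<Sum>i\<in>I. smult (a i) (v i)) (w j))"
    by (simp only: R.sum R.scale)
  also have "\<dots> = (\<Sum>j\<in>J. b j * (\<Sum>i\<in>I. a i * B (v i) (w j)))"
    by (simp only: L.sum L.scale)
  also have "\<dots> = (\<Sum>j\<in>J. \<Sum>i\<in>I. a i * B (v i) (w j) * b j)"
    by (intro sum.cong refl) (subst mult.commute, rule sum_distrib_right)
  finally show ?thesis .
qed

text \<open>The change of basis formula for Gram matrices.\<close>

lemma bilinear_form_smat_apply:
  assumes "bilinear_form B" and S: "lower_unitriangular S" "lower_unitriangular T"
  shows "B (smat_apply S chi k) (smat_apply T chi l)
       = smat_times (smat_times S (gram B)) (smat_transpose T) k l"
proof -
  have "B (smat_apply S chi k) (smat_apply T chi l)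
      = (\<Sum>j\<le>l. \<Sum>i\<le>k. S k i * B (chi i) (chi j) * T l j)"
    unfolding smat_apply_lower[OF S(1)] smat_apply_lower[OF S(2)]
    by (rule bilinear_form_sum[OF assms(1)])
  also have "\<dots> = (\<Sum>j\<le>l. smat_times S (gram B) k j * T l j)"
    unfolding smat_times_lower_left[OF S(1)] sum_distrib_right
    by (simp only: gram_def chi_def)
  also have "\<dots> = smat_times (smat_times S (gram B)) (smat_transpose T) k l"
    by (rule smat_times_upper_right[OF S(2), symmetric])
  finally show ?thesis .
qed

theorem proposition5:
  fixes B :: "complex poly \<Rightarrow> complex poly \<Rightarrow> complex" and k l :: nat
  assumes "bilinear_form B" and "quasi_definite B"
  shows "B (P1 B k) (P2 B l) = (if l = k then LDU_H (gram B) k else 0)"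
proof -
  have "minors_nonzero (gram B)"
    using assms(2) by (simp add: quasi_definite_def minors_nonzero_def)
  from is_LDU_LDU[OF this] show ?thesis
    by (auto simp: is_LDU_iff P1_def P2_def bilinear_form_smat_apply[OF assms(1)] smat_diag_def)
qed

end
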